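(* There is an absolute constant $C>0$ such that for every integer $N\ge 2$ there exists a set $\mathcal A_N\subset[0,1]^2$ of $N$ points (a digit-scrambled van der Corput set, or an initial segment of one) whose discrepancy function satisfies \[ \|D_N\|_{\exp(L^\alpha)}\ \le\ C\,(\log N)^{1-1/\alpha}\qquad\text{for all }2\le\alpha<\infty. \]
   Context: For an $N$-point set $\mathcal A_N\subset[0,1]^2$ and $\vec x=(x_1,x_2)\in[0,1]^2$, the discrepancy function is $D_N(\vec x)=\sharp\big(\mathcal A_N\cap[0,x_1)\times[0,x_2)\big)-N x_1x_2$. For $\alpha\ge 2$, $\exp(L^\alpha)$ denotes the Orlicz space on $[0,1]^2$ (Lebesgue measure) with norm $\|f\|_{\exp(L^\alpha)}=\inf\{K>0:\int_{[0,1]^2}\psi_\alpha(f/K)\le 1\}$, where $\psi_\alpha(x)=e^{|x|^\alpha}-1$. Digit-scrambled van der Corput set: for $x\in[0,1)$ let $d_i(x)=\lfloor 2^i x\rfloor \bmod 2$. For $n\ge1$ and $\sigma\in[0,1)$ (only its first $n$ binary digits are used), define $x\oplus\sigma$ by $d_i(x\oplus\sigma)=d_i(x)+d_i(\sigma)\bmod 2$ for $i\le n$ (and $d_i(x\oplus\sigma)=d_i(x)$ otherwise), and $\mathrm{rev}_n(x)$ by $d_i(\mathrm{rev}_n x)=d_{n+1-i}(x)$ for $1\le i\le n$, $0$ otherwise. Then $\mathcal V_{n,\sigma}=\{(\tau/2^n,\ \mathrm{rev}_n(\tau/2^n\oplus\sigma))+(2^{-n-1},2^{-n-1}):\tau=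0,1,\dots,2^n-1\}$.
   Formalization: An "initial segment" is the first N points of the scrambled van der Corput set with the first coordinate multiplied by 2^n/N; without this stretching the claim fails, e.g. for N = 3·2^k, where all points have x_1 < 3/4. *)

theory Defs
  imports "HOL-Analysis.Analysis"
begin

definition unit_square :: "(real \<times> real) set" where
  "unit_square = {0..1} \<times> {0..1}"

definition discrepancy :: "(real \<times> real) set \<Rightarrow> real \<times> real \<Rightarrow> real" where
  "discrepancy A x =
     real (card (A \<inter> ({0..<fst x} \<times> {0..<snd x}))) - real (card A) * fst x * snd x"

definition exp_young :: "real \<Rightarrow> real \<Rightarrow> real" where
  "exp_young \<alpha> x = exp (\<bar>x\<bar> powr \<alpha>) - 1"

text \<open>The norm takes values in \<^typ>\<open>ennreal\<close>, so that it is infinite (an infimum over the empty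
  set) for functions outside of the Orlicz space.\<close>

definition exp_Orlicz_norm :: "real \<Rightarrow> (real \<times> real \<Rightarrow> real) \<Rightarrow> ennreal" where
  "exp_Orlicz_norm \<alpha> f =
     Inf (ennreal ` {K. K > 0 \<and>
       (\<integral>\<^sup>+x\<in>unit_square. ennreal (exp_young \<alpha> (f x / K)) \<partial>lborel) \<le> 1})"

definition bdigit :: "nat \<Rightarrow> real \<Rightarrow> int" where
  "bdigit i x = \<lfloor>2 ^ i * x\<rfloor> mod 2"

text \<open>The number with prescribed binary digits at the positions 1, 2, and so on; the value at
  position 0 is ignored. The digit sequences used below are never eventually 1 when the
  argument lies in $[0,1)$, so they are the \<^const>\<open>bdigit\<close> sequences of the resulting
  numbers.\<close>

definition of_bdigits :: "(nat \<Rightarrow> int) \<Rightarrow> real" where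
  "of_bdigits d = (\<Sum>i. real_of_int (d (Suc i)) / 2 ^ Suc i)"

definition digit_shift :: "nat \<Rightarrow> real \<Rightarrow> real \<Rightarrow> real" where
  "digit_shift n \<sigma> x =
     of_bdigits (\<lambda>i. if i \<le> n then (bdigit i x + bdigit i \<sigma>) mod 2 else bdigit i x)"

definition digit_rev :: "nat \<Rightarrow> real \<Rightarrow> real" where
  "digit_rev n x =
     of_bdigits (\<lambda>i. if 1 \<le> i \<and> i \<le> n then bdigit (n + 1 - i) x else 0)"

definition vdC_point :: "nat \<Rightarrow> real \<Rightarrow> nat \<Rightarrow> real \<times> real" where
  "vdC_point n \<sigma> \<tau> =
     (real \<tau> / 2 ^ n, digit_rev n (digit_shift n \<sigma> (real \<tau> / 2 ^ n)))
       + (1 / 2 ^ (n + 1), 1 / 2 ^ (n + 1))"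

definition vdC_set :: "nat \<Rightarrow> real \<Rightarrow> (real \<times> real) set" where
  "vdC_set n \<sigma> = vdC_point n \<sigma> ` {0..<2 ^ n}"

text \<open>The first $N$ points of a scrambled van der Corput set (for $N \<le> 2^n$) are its points in
  $[0, N/2^n) \<times> [0,1]$. To become a point set for the unit square, this strip is stretched
  onto $[0,1) \<times> [0,1]$; without the stretching, the part of the square to the right of the
  strip would be empty and the discrepancy would in general be of order $N$.\<close>

definition vdC_initial_segment :: "nat \<Rightarrow> real \<Rightarrow> nat \<Rightarrow> (real \<times> real) set" where
  "vdC_initial_segment n \<sigma> N =
     (\<lambda>(x, y). (2 ^ n / real N * x, y)) ` vdC_point n \<sigma> ` {0..<N}"

end

theory Submission
  imports Defs "HOL-Probability.Hoeffding"
begin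

text \<open>
  Initial segments serve for every \<open>N\<close>, with \<open>2 ^ (n - 1) \<le> N < 2 ^ n\<close> and the shift \<open>1 / 3\<close>, whose binary
  digits alternate. Up to bounded errors, the discrepancy at \<open>(x, y)\<close> is that of the points with index
  below \<open>s\<close> (the integer nearest to \<open>N x\<close>) and second coordinate below \<open>\<lfloor>2 ^ n y\<rfloor> / 2 ^ n\<close>. Revealing the
  binary digits of \<open>s\<close> and \<open>y\<close> one pair at a time adds one bounded term per step. After subtracting the
  drift \<open>\<plusminus> 1 / 8\<close> of each term, whose sign is governed by the shift digit so that the drifts cancel up to
  a constant, and adding half of a sawtooth function, the partial sums form a martingale with bounded
  increments. Its \<open>exp (L\<^sup>2)\<close> norm is thus of order \<open>sqrt n\<close>, and its sup norm is at most of order \<open>n\<close>;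
  interpolating between the two bounds gives all \<open>\<alpha> \<ge> 2\<close> with the same constant.
\<close>

section \<open>Exponential moments of martingale steps\<close>

lemma cosh_le_exp_square_half: "cosh x \<le> exp (x\<^sup>2 / 2)" for x :: real
proof -
  have *: "cosh x \<le> exp (x\<^sup>2 / 2)" if "x \<ge> 0" for x :: real
  proof -
    \<comment> \<open>Hoeffding's auxiliary inequality for a fair two-point distribution with gap
      \<open>2 * x\<close>. It needs a nonnegative gap; evenness of both sides gives the
      rest.\<close>
    have "ln ((1 + exp (2 * x)) / 2) \<le> x + x\<^sup>2 / 2"
      using Hoeffdings_lemma_aux[of "2 * x" "1 / 2"] that by (simp add: field_simps)
    then have "(1 + exp (2 * x)) / 2 \<le> exp (x + x\<^sup>2 / 2)"
      by (smt (verit) divide_pos_pos exp_gt_zero exp_ln exp_le_cancel_iff)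
    moreover have "(1 + exp (2 * x)) / 2 = exp x * cosh x"
      by (simp add: cosh_def exp_minus field_simps flip: exp_add mult_exp_exp)
    ultimately show ?thesis
      by (simp add: exp_add)
  qed
  show ?thesis
    using *[of "\<bar>x\<bar>"] by simp
qed

text \<open>Convexity: the right-hand side is the chord of exp over [-c, c].\<close>

lemma exp_le_cosh_sinh:
  fixes c y :: real
  assumes "c > 0" "\<bar>y\<bar> \<le> c"
  shows "exp y \<le> cosh c + y / c * sinh c"
proof -
  define t where "t = (1 + y / c) / 2"
  have t: "0 \<le> t" "t \<le> 1"
    using assms by (auto simp: t_def field_simps)
  have "exp ((1 - t) *\<^sub>R (- c) + t *\<^sub>R c) \<le> (1 - t) * exp (- c) + t * exp c"
    by (rule convex_onD[OF exp_convex]) (use t in auto)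
  moreover have "(1 - t) *\<^sub>R (- c) + t *\<^sub>R c = y"
    using assms by (simp add: t_def field_simps)
  moreover have "(1 - t) * exp (- c) + t * exp c = cosh c + y / c * sinh c"
    using assms by (simp add: t_def cosh_def sinh_def field_simps)
  ultimately show ?thesis
    by simp
qed

text \<open>Hoeffding's lemma for the uniform distribution on \<open>I\<close>: once exp is replaced
  by its chord, the linear term sums to 0 and only \<open>cosh c\<close> remains.\<close>

lemma sum_exp_le_of_sum_eq_0:
  fixes f :: "'a \<Rightarrow> real"
  assumes "finite I" and bound: "\<And>i. i \<in> I \<Longrightarrow> \<bar>f i\<bar> \<le> c" and "sum f I = 0"
  shows "(\<Sum>i\<in>I. exp (f i)) \<le> real (card I) * exp (c\<^sup>2 / 2)"
proof (cases "c > 0")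
  case True
  have "(\<Sum>i\<in>I. exp (f i)) \<le> (\<Sum>i\<in>I. cosh c + f i / c * sinh c)"
    using bound by (intro sum_mono exp_le_cosh_sinh True) auto
  also have "\<dots> = real (card I) * cosh c + sum f I / c * sinh c"
    by (simp add: sum.distrib sum_distrib_right sum_divide_distrib)
  also have "\<dots> = real (card I) * cosh c"
    using assms(3) by simp
  also have "\<dots> \<le> real (card I) * exp (c\<^sup>2 / 2)"
    by (intro mult_left_mono cosh_le_exp_square_half) auto
  finally show ?thesis .
next
  case False
  have "f i = 0 \<and> c = 0" if "i \<in> I" for i
    using bound[OF that] False by auto
  then have "(\<Sum>i\<in>I. exp (f i)) = (\<Sum>i\<in>I. exp (c\<^sup>2 / 2))"
    by (intro sum.cong) auto
  then show ?thesis
    by simp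
qed

text \<open>
  One martingale step. The Gaussian cross term produced by a step enlarges the coefficient of \<open>T\<^sup>2\<close>, and
  writing the coefficient as \<open>1 / (2 B\<^sup>2 a)\<close> turns this loss into the replacement of \<open>a\<close> by \<open>a - 1\<close>.
\<close>

lemma sum_exp_square_le:
  fixes f :: "'a \<Rightarrow> real" and B T a :: real
  assumes "finite I" and bound: "\<And>i. i \<in> I \<Longrightarrow> \<bar>f i\<bar> \<le> B" and "sum f I = 0"
    and "B > 0" "a > 1"
  shows "(\<Sum>i\<in>I. exp ((T + f i)\<^sup>2 / (2 * B\<^sup>2 * a)))
       \<le> real (card I) * (exp (1 / (2 * a)) * exp (T\<^sup>2 / (2 * B\<^sup>2 * (a - 1))))"
proof -
  define \<theta> where "\<theta> = 1 / (2 * B\<^sup>2 * a)"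
  have \<theta>: "\<theta> > 0"
    using assms by (auto simp: \<theta>_def)
  have \<theta>B: "\<theta> * B\<^sup>2 = 1 / (2 * a)"
    using assms by (auto simp: \<theta>_def)
  have exponent: "\<theta> + 2 * \<theta>\<^sup>2 * B\<^sup>2 \<le> 1 / (2 * B\<^sup>2 * (a - 1))"
  proof -
    have "\<theta> + 2 * \<theta>\<^sup>2 * B\<^sup>2 = 1 / (2 * B\<^sup>2) * ((a + 1) / a\<^sup>2)"
      using assms by (simp add: \<theta>_def field_simps power2_eq_square)
    \<comment> \<open>Clearing denominators leaves
      \<open>(a + 1) * (a - 1) \<le> a\<^sup>2\<close>.\<close>
    also have "\<dots> \<le> 1 / (2 * B\<^sup>2) * (1 / (a - 1))"
      using assms by (intro mult_left_mono) (auto simp: field_simps power2_eq_square)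
    finally show ?thesis
      by simp
  qed
  have "(\<Sum>i\<in>I. exp ((T + f i)\<^sup>2 / (2 * B\<^sup>2 * a)))
      \<le> (\<Sum>i\<in>I. exp (\<theta> * T\<^sup>2 + \<theta> * B\<^sup>2) * exp (2 * \<theta> * T * f i))"
  proof (rule sum_mono)
    fix i assume "i \<in> I"
    then have "(f i)\<^sup>2 \<le> B\<^sup>2"
      using bound[of i] by (simp add: abs_le_square_iff[symmetric])
    then have "\<theta> * (f i)\<^sup>2 \<le> \<theta> * B\<^sup>2"
      using \<theta> by (simp add: mult_left_mono)
    moreover have "(T + f i)\<^sup>2 / (2 * B\<^sup>2 * a) = \<theta> * T\<^sup>2 + \<theta> * (f i)\<^sup>2 + 2 * \<theta> * T * f i"
      by (simp add: \<theta>_def power2_eq_square field_simps add_divide_distrib)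
    ultimately show "exp ((T + f i)\<^sup>2 / (2 * B\<^sup>2 * a))
        \<le> exp (\<theta> * T\<^sup>2 + \<theta> * B\<^sup>2) * exp (2 * \<theta> * T * f i)"
      by (simp flip: exp_add)
  qed
  also have "\<dots> = exp (\<theta> * T\<^sup>2 + \<theta> * B\<^sup>2) * (\<Sum>i\<in>I. exp (2 * \<theta> * T * f i))"
    by (simp add: sum_distrib_left)
  also have "\<dots> \<le> exp (\<theta> * T\<^sup>2 + \<theta> * B\<^sup>2) * (real (card I) * exp ((2 * \<theta> * \<bar>T\<bar> * B)\<^sup>2 / 2))"
    using assms \<theta>
    by (intro mult_left_mono sum_exp_le_of_sum_eq_0)
       (auto simp: abs_mult mult_left_mono simp flip: sum_distrib_left)
  also have "\<dots> = real (card I) * (exp (1 / (2 * a)) * exp ((\<theta> + 2 * \<theta>\<^sup>2 * B\<^sup>2) * T\<^sup>2))"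
  proof -
    have "\<theta> * T\<^sup>2 + \<theta> * B\<^sup>2 + (2 * \<theta> * \<bar>T\<bar> * B)\<^sup>2 / 2
        = 1 / (2 * a) + (\<theta> + 2 * \<theta>\<^sup>2 * B\<^sup>2) * T\<^sup>2"
      unfolding \<theta>B by (simp add: power_mult_distrib algebra_simps)
    then show ?thesis
      by (metis (no_types, lifting) exp_add mult.left_commute)
  qed
  also have "\<dots> \<le> real (card I) * (exp (1 / (2 * a)) * exp (T\<^sup>2 / (2 * B\<^sup>2 * (a - 1))))"
  proof -
    have "(\<theta> + 2 * \<theta>\<^sup>2 * B\<^sup>2) * T\<^sup>2 \<le> 1 / (2 * B\<^sup>2 * (a - 1)) * T\<^sup>2"
      by (intro mult_right_mono exponent) auto
    then show ?thesis
      by (intro mult_left_mono) auto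
  qed
  finally show ?thesis .
qed

section \<open>Scrambled bit reversal\<close>

text \<open>
  The reversal of the \<open>k\<close> lowest bits of \<open>t\<close>, as an integer, where \<open>e j\<close> is added to the bit of weight \<open>2 ^ j\<close>.
\<close>

fun scrambled_rev :: "(nat \<Rightarrow> nat) \<Rightarrow> nat \<Rightarrow> nat \<Rightarrow> nat" where
  "scrambled_rev e 0 t = 0"
| "scrambled_rev e (Suc k) t = 2 * scrambled_rev e k t + (t div 2 ^ k + e k) mod 2"

lemma scrambled_rev_less: "scrambled_rev e k t < 2 ^ k"
proof (induction k)
  case (Suc k)
  have "(t div 2 ^ k + e k) mod 2 < 2"
    by simp
  with Suc show ?case
    unfolding scrambled_rev.simps power_Suc by linarith
qed simp

text \<open>The reversal reads only the \<open>k\<close> lowest bits, which a multiple of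
  \<open>2 ^ j\<close> leaves alone.\<close>

lemma scrambled_rev_add:
  assumes "k \<le> j"
  shows "scrambled_rev e k (c * 2 ^ j + t) = scrambled_rev e k t"
  using assms
proof (induction k)
  case (Suc k)
  have "c * 2 ^ j = (2 * (c * 2 ^ (j - Suc k))) * 2 ^ k"
    using Suc.prems by (simp add: power_add[symmetric] mult.assoc flip: power_Suc)
  then have "(c * 2 ^ j + t) div 2 ^ k = 2 * (c * 2 ^ (j - Suc k)) + t div 2 ^ k"
    by (metis div_mult_self3 power_not_zero zero_neq_numeral)
  then have "((c * 2 ^ j + t) div 2 ^ k + e k) mod 2 = (t div 2 ^ k + e k) mod 2"
    by (metis add.assoc mod_mult_self4)
  with Suc show ?case
    by simp
qed simp

lemma less_power_Suc_cases:
  assumes "t < 2 ^ Suc k"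
  obtains c u :: nat where "t = c * 2 ^ k + u" "c < 2" "u < 2 ^ k"
proof
  show "t = t div 2 ^ k * 2 ^ k + t mod 2 ^ k"
    by (rule div_mult_mod_eq[symmetric])
  show "t div 2 ^ k < 2"
    using assms by (simp add: less_mult_imp_div_less)
qed simp

lemma digit_add_mod_2_cancel:
  fixes c c' d :: nat
  assumes "(c + d) mod 2 = (c' + d) mod 2" "c < 2" "c' < 2"
  shows "c = c'"
  using assms by presburger

text \<open>The leading bit of the argument is, up to the shift \<open>e k\<close>, the last bit of
  the value. Parity recovers it, and the remaining bits form the shorter reversal.\<close>

lemma inj_on_scrambled_rev: "inj_on (scrambled_rev e k) {..<2 ^ k}"
proof (induction k)
  case (Suc k)
  show ?case
  proof (rule inj_onI)
    fix t t' assume "t \<in> {..<2 ^ Suc k}" "t' \<in> {..<2 ^ Suc k}"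
      and eq: "scrambled_rev e (Suc k) t = scrambled_rev e (Suc k) t'"
    then obtain c u c' u' where t: "t = c * 2 ^ k + u" "c < 2" "u < 2 ^ k"
      and t': "t' = c' * 2 ^ k + u'" "c' < 2" "u' < 2 ^ k"
      by (metis lessThan_iff less_power_Suc_cases)
    have "2 * scrambled_rev e k u + (c + e k) mod 2 = 2 * scrambled_rev e k u' + (c' + e k) mod 2"
      using eq t t' by (simp add: scrambled_rev_add)
    then have "scrambled_rev e k u = scrambled_rev e k u'" "(c + e k) mod 2 = (c' + e k) mod 2"
      by presburger+
    then show "t = t'"
      using Suc t t' digit_add_mod_2_cancel by (metis inj_onD lessThan_iff)
  qed
qed (auto simp: inj_on_def)

lemma bij_betw_scrambled_rev: "bij_betw (scrambled_rev e k) {..<2 ^ k} {..<2 ^ k}"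
  unfolding bij_betw_def
proof
  show "scrambled_rev e k ` {..<2 ^ k} = {..<2 ^ k}"
    by (rule card_subset_eq)
       (auto simp: scrambled_rev_less card_image[OF inj_on_scrambled_rev])
qed (rule inj_on_scrambled_rev)

section \<open>Counting indices and reversed values in a box\<close>

definition rev_count :: "(nat \<Rightarrow> nat) \<Rightarrow> nat \<Rightarrow> nat \<Rightarrow> nat \<Rightarrow> nat" where
  "rev_count e k s w = card {t. t < s \<and> scrambled_rev e k t < w}"

lemma rev_count_full:
  assumes "w \<le> 2 ^ k"
  shows "rev_count e k (2 ^ k) w = w"
proof -
  have "scrambled_rev e k ` {t. t < 2 ^ k \<and> scrambled_rev e k t < w} = {..<w}"
    (is "_ ` ?A = _")
  proof
    show "{..<w} \<subseteq> scrambled_rev e k ` ?A"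
    proof
      fix v assume "v \<in> {..<w}"
      with assms have "v \<in> scrambled_rev e k ` {..<2 ^ k}"
        using bij_betw_imp_surj_on[OF bij_betw_scrambled_rev[of e k]] by auto
      with \<open>v \<in> {..<w}\<close> show "v \<in> scrambled_rev e k ` ?A"
        by auto
    qed
  qed auto
  moreover have "inj_on (scrambled_rev e k) ?A"
    by (rule inj_on_subset[OF inj_on_scrambled_rev]) auto
  ultimately show ?thesis
    unfolding rev_count_def by (metis card_image card_lessThan)
qed

text \<open>A full block of \<open>2 ^ k\<close> indices takes each value below \<open>2 ^ k\<close>
  exactly once and so contributes \<open>w\<close>; the indices after it behave like those starting
  at 0.\<close>

lemma rev_count_block:
  assumes "c < 2" "w \<le> 2 ^ k"
  shows "rev_count e k (c * 2 ^ k + s) w = c * w + rev_count e k s w"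
proof (cases "c = 0")
  case False
  with assms have c: "c = 1"
    by simp
  let ?A = "\<lambda>s. {t. t < s \<and> scrambled_rev e k t < w}"
  have "?A (2 ^ k + s) = ?A (2 ^ k) \<union> (\<lambda>t. 2 ^ k + t) ` ?A s"
  proof (intro equalityI subsetI)
    fix t assume t: "t \<in> ?A (2 ^ k + s)"
    show "t \<in> ?A (2 ^ k) \<union> (\<lambda>t. 2 ^ k + t) ` ?A s"
    proof (cases "t < 2 ^ k")
      case False
      then obtain u where u: "t = 2 ^ k + u"
        by (metis le_iff_add not_less)
      with t have "u \<in> ?A s"
        using scrambled_rev_add[of k k e 1 u] by simp
      with u show ?thesis
        by blast
    qed (use t in auto)
  next
    fix t assume "t \<in> ?A (2 ^ k) \<union> (\<lambda>t. 2 ^ k + t) ` ?A s"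
    then show "t \<in> ?A (2 ^ k + s)"
      using scrambled_rev_add[of k k e 1] by auto
  qed
  then have "card (?A (2 ^ k + s)) = card (?A (2 ^ k)) + card ((\<lambda>t. 2 ^ k + t) ` ?A s)"
    by (simp only:) (intro card_Un_disjoint, auto)
  also have "card ((\<lambda>t. 2 ^ k + t) ` ?A s) = card (?A s)"
    by (intro card_image) auto
  finally show ?thesis
    using c rev_count_full[OF assms(2), of e] by (simp add: rev_count_def)
qed simp

text \<open>Equality of the reversals forces the \<open>k\<close> lowest bits of \<open>t\<close> to
  be those of \<open>r\<close>, and the vanishing last digit forces the leading bit to be
  \<open>e k\<close>. Only one candidate is left.\<close>

lemma card_scrambled_rev_fibre:
  assumes "e k < 2" "r < 2 ^ k" "S \<le> 2 ^ Suc k"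
  shows "card {t. t < S \<and> scrambled_rev e k t = scrambled_rev e k r \<and> (t div 2 ^ k + e k) mod 2 = 0}
    = (if r + e k * 2 ^ k < S then 1 else 0)"
proof -
  define a where "a = r + e k * 2 ^ k"
  define L where "L = {t. t < S \<and> scrambled_rev e k t = scrambled_rev e k r
    \<and> (t div 2 ^ k + e k) mod 2 = 0}"
  have only: "t = a \<and> t < S" if t: "t \<in> L" for t
  proof
    show "t < S"
      using t by (simp add: L_def)
    with assms have "t < 2 ^ Suc k"
      by simp
    then obtain c u where u: "t = c * 2 ^ k + u" "c < 2" "u < 2 ^ k"
      by (rule less_power_Suc_cases)
    with t have "scrambled_rev e k u = scrambled_rev e k r"
      by (simp add: L_def scrambled_rev_add)
    with assms u have "u = r"
      using inj_on_scrambled_rev[of e k] by (metis inj_onD lessThan_iff)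
    have "(c + e k) mod 2 = (e k + e k) mod 2"
      using t u by (simp add: L_def)
    then have "c = e k"
      using u assms digit_add_mod_2_cancel by blast
    with u \<open>u = r\<close> show "t = a"
      by (simp add: a_def)
  qed
  have mem: "a \<in> L" if "a < S"
    using that assms scrambled_rev_add[of k k e "e k" r] by (simp add: a_def L_def add.commute)
  have "card L = (if a < S then 1 else 0)"
  proof (cases "a < S")
    case True
    have "L = {a}"
    proof
      show "L \<subseteq> {a}"
        using only by blast
      show "{a} \<subseteq> L"
        using mem[OF True] by blast
    qed
    with True show ?thesis
      by simp
  next
    case False
    have "L = {}"
      using only False by blast
    with False show ?thesis
      by simp
  qed
  then show ?thesis
    by (simp only: L_def a_def)
qed

text \<open>Comparing values digit by digit, \<open>t\<close> is counted if its first
  \<open>k\<close> digits give less than those of \<open>r\<close>, or if they agree and the last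
  digits are 0 for \<open>t\<close> and 1 for \<open>r\<close>. The first kind is counted by blocks,
  the second is the single index of the fibre.\<close>

lemma rev_count_Suc:
  assumes "m < 2" "b < 2" "e k < 2" "s < 2 ^ k" "r < 2 ^ k"
  shows "rev_count e (Suc k) (m * 2 ^ k + s) (scrambled_rev e (Suc k) (b * 2 ^ k + r))
    = m * scrambled_rev e k r + rev_count e k s (scrambled_rev e k r)
      + (b + e k) mod 2 * (if r + e k * 2 ^ k < m * 2 ^ k + s then 1 else 0)"
proof -
  define S where "S = m * 2 ^ k + s"
  define y where "y = (b + e k) mod 2"
  define A where "A = {t. t < S \<and> scrambled_rev e k t < scrambled_rev e k r}"
  define F where "F = {t. t < S \<and> scrambled_rev e k t = scrambled_rev e k r
    \<and> (t div 2 ^ k + e k) mod 2 = 0}"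
  have S: "S \<le> 2 ^ Suc k"
    using assms by (auto simp: S_def less_2_cases_iff)
  have y: "y = 0 \<or> y = 1"
    by (auto simp: y_def)
  have rev_r: "scrambled_rev e (Suc k) (b * 2 ^ k + r) = 2 * scrambled_rev e k r + y"
    using assms by (simp add: scrambled_rev_add y_def)
  have "scrambled_rev e (Suc k) t < 2 * scrambled_rev e k r + y \<longleftrightarrow>
      scrambled_rev e k t < scrambled_rev e k r \<or>
      y = 1 \<and> scrambled_rev e k t = scrambled_rev e k r \<and> (t div 2 ^ k + e k) mod 2 = 0" for t
  proof -
    have "(t div 2 ^ k + e k) mod 2 < 2"
      by simp
    with y show ?thesis
      unfolding scrambled_rev.simps by linarith
  qed
  then have "{t. t < S \<and> scrambled_rev e (Suc k) t < 2 * scrambled_rev e k r + y}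
      = A \<union> (if y = 1 then F else {})"
    unfolding A_def F_def by (simp del: scrambled_rev.simps) blast
  moreover have "finite A" "finite F" "A \<inter> F = {}"
    by (auto simp: A_def F_def)
  ultimately have "rev_count e (Suc k) S (2 * scrambled_rev e k r + y) = card A + y * card F"
    using y by (auto simp: rev_count_def card_Un_disjoint)
  moreover have "card A = m * scrambled_rev e k r + rev_count e k s (scrambled_rev e k r)"
    using rev_count_block[of m "scrambled_rev e k r" k e s] assms scrambled_rev_less[of e k r]
    by (simp add: A_def S_def rev_count_def)
  moreover have "card F = (if r + e k * 2 ^ k < S then 1 else 0)"
    unfolding F_def using assms S by (intro card_scrambled_rev_fibre)
  ultimately show ?thesis
    unfolding rev_r by (simp only: S_def y_def)
qed

section \<open>The compensated discrepancy\<close>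

lemma block_less_iff:
  fixes c d r s :: nat
  assumes "r < 2 ^ k" "s < 2 ^ k"
  shows "c * 2 ^ k + r < d * 2 ^ k + s \<longleftrightarrow> c < d \<or> c = d \<and> r < s"
proof -
  have *: "c' * 2 ^ k + r' < d' * 2 ^ k + s'" if "c' < d'" "r' < 2 ^ k" for c' d' r' s' :: nat
  proof -
    have "Suc c' * 2 ^ k \<le> d' * 2 ^ k"
      using that by (intro mult_right_mono) auto
    with that show ?thesis
      by simp
  qed
  consider "c < d" | "c = d" | "d < c"
    by linarith
  then show ?thesis
  proof cases
    case 1
    with *[OF 1 assms(1)] show ?thesis
      by simp
  next
    case 3
    with *[OF 3 assms(2), of r] show ?thesis
      by simp
  qed simp
qed

text \<open>
  The upper end of the second interval is given as the scrambled reversal of \<open>r\<close>, so that both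
  arguments grow by their leading bit when \<open>k\<close> increases.
\<close>

definition rev_discrepancy :: "(nat \<Rightarrow> nat) \<Rightarrow> nat \<Rightarrow> nat \<Rightarrow> nat \<Rightarrow> real" where
  "rev_discrepancy e k s r =
     real (rev_count e k s (scrambled_rev e k r)) - real s * real (scrambled_rev e k r) / 2 ^ k"

text \<open>For \<open>s \<le> 2 ^ k\<close> this has mean 0 over \<open>r < 2 ^ k\<close>: it is
  the discrepancy of a single random point.\<close>

definition sawtooth :: "nat \<Rightarrow> nat \<Rightarrow> nat \<Rightarrow> real" where
  "sawtooth k s r = of_bool (r < s) - real s / 2 ^ k"

text \<open>
  A step of \<^const>\<open>rev_discrepancy\<close> has conditional mean \<open>(1 - 2 e\<^sub>k) / 8 + sawtooth / 4\<close>, while the mean of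
  the next sawtooth is half of the present one; hence the summand \<open>sawtooth / 2\<close> makes the sum a martingale.
\<close>

definition compensated :: "(nat \<Rightarrow> nat) \<Rightarrow> nat \<Rightarrow> nat \<Rightarrow> nat \<Rightarrow> real" where
  "compensated e k s r =
     rev_discrepancy e k s r - (\<Sum>j<k. (1 - 2 * real (e j)) / 8) + sawtooth k s r / 2"

text \<open>Doubling the height and the scale together changes nothing, and full blocks carry no
  discrepancy. Hence only the new last digit of the height contributes, and only if it is 1.\<close>

lemma rev_discrepancy_Suc:
  assumes "m < 2" "b < 2" "e k < 2" "s < 2 ^ k" "r < 2 ^ k"
  shows "rev_discrepancy e (Suc k) (m * 2 ^ k + s) (b * 2 ^ k + r)
    = rev_discrepancy e k s r
      + real ((b + e k) mod 2) * sawtooth (Suc k) (m * 2 ^ k + s) (e k * 2 ^ k + r)"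
proof -
  define y where "y = (b + e k) mod 2"
  have "scrambled_rev e (Suc k) (b * 2 ^ k + r) = 2 * scrambled_rev e k r + y"
    using assms by (simp add: scrambled_rev_add y_def)
  moreover have "rev_count e (Suc k) (m * 2 ^ k + s) (scrambled_rev e (Suc k) (b * 2 ^ k + r))
    = m * scrambled_rev e k r + rev_count e k s (scrambled_rev e k r)
      + y * of_bool (e k * 2 ^ k + r < m * 2 ^ k + s)"
    using rev_count_Suc[of m b e k s r] assms by (simp add: y_def add.commute del: scrambled_rev.simps)
  ultimately show ?thesis
    unfolding rev_discrepancy_def sawtooth_def y_def[symmetric]
    by (simp add: field_simps)
qed

text \<open>The martingale property: given the lower bits, the four choices of new leading bits have
  increments of mean 0.\<close>

lemma compensated_increment:
  assumes "e k < 2" "s < 2 ^ k" "r < 2 ^ k"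
  defines "inc \<equiv> \<lambda>(m, b). compensated e (Suc k) (m * 2 ^ k + s) (b * 2 ^ k + r) - compensated e k s r"
  shows "sum inc ({..<2} \<times> {..<2}) = 0" and "\<And>i. i \<in> {..<2} \<times> {..<2} \<Longrightarrow> \<bar>inc i\<bar> \<le> 3"
proof -
  define x where "x = real s / 2 ^ k"
  define z :: real where "z = of_bool (r < s)"
  have "real s < 2 ^ k"
    using assms(2) by simp
  then have x: "0 \<le> x" "x \<le> 1"
    by (simp_all add: x_def)
  have z: "0 \<le> z" "z \<le> 1"
    by (auto simp: z_def)
  \<comment> \<open>The new sawtooth depends on the lower bits only through \<open>x\<close> and
    \<open>z\<close>, so the sum over the four bit pairs becomes an explicit identity.\<close>
  have saw: "sawtooth (Suc k) (m * 2 ^ k + s) (c * 2 ^ k + r)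
      = (if c < m then 1 else if c = m then z else 0) - (real m + x) / 2" for m c
    using assms by (simp add: sawtooth_def block_less_iff x_def z_def add_divide_distrib)
  have inc: "inc (m, b) = real ((b + e k) mod 2)
        * ((if e k < m then 1 else if e k = m then z else 0) - (real m + x) / 2)
      - (1 - 2 * real (e k)) / 8
      + ((if b < m then 1 else if b = m then z else 0) - (real m + x) / 2 - (z - x)) / 2"
    if "m < 2" "b < 2" for m b
    using assms that
    by (simp add: inc_def compensated_def rev_discrepancy_Suc saw diff_divide_distrib
        add_divide_distrib sawtooth_def[of k] flip: x_def z_def)
  have e: "e k = 0 \<or> e k = 1"
    using assms(1) by auto
  have "{..<2::nat} = {0, 1}"
    by auto
  then have "sum inc ({..<2} \<times> {..<2}) = inc (0, 0) + inc (0, 1) + inc (1, 0) + inc (1, 1)"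
    by (simp add: insert_Times_insert)
  also have "\<dots> = 0"
    using e by (auto simp: inc field_simps)
  finally show "sum inc ({..<2} \<times> {..<2}) = 0" .
  \<comment> \<open>The three parts of the increment are at most 1, 1/8 and 1 in absolute value; 3
    is a round bound.\<close>
  show "\<bar>inc i\<bar> \<le> 3" if i: "i \<in> {..<2} \<times> {..<2}" for i
  proof -
    obtain m b where "i = (m, b)" "m < 2" "b < 2"
      using i by auto
    then show ?thesis
      using e x z by (auto simp: inc less_2_cases_iff abs_le_iff field_simps)
  qed
qed

lemma abs_compensated_le:
  assumes "\<And>j. j < k \<Longrightarrow> e j < 2" "s < 2 ^ k" "r < 2 ^ k"
  shows "\<bar>compensated e k s r\<bar> \<le> 3 * real k"
  using assms
proof (induction k arbitrary: s r)
  case 0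
  then show ?case
    by (simp add: compensated_def rev_discrepancy_def sawtooth_def rev_count_def)
next
  case (Suc k)
  obtain m s' where s: "s = m * 2 ^ k + s'" "m < 2" "s' < 2 ^ k"
    using Suc.prems by (metis less_power_Suc_cases)
  obtain b r' where r: "r = b * 2 ^ k + r'" "b < 2" "r' < 2 ^ k"
    using Suc.prems by (metis less_power_Suc_cases)
  have "\<bar>compensated e (Suc k) s r - compensated e k s' r'\<bar> \<le> 3"
    using compensated_increment(2)[of e k s' r' "(m, b)"] Suc.prems s r by simp
  moreover have "\<bar>compensated e k s' r'\<bar> \<le> 3 * real k"
    using Suc s r by simp
  ultimately show ?case
    by simp
qed

section \<open>Exponential square moments of the martingale\<close>

lemma sum_lessThan_power_Suc:
  fixes g :: "nat \<Rightarrow> 'a::comm_monoid_add"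
  shows "(\<Sum>s<2 ^ Suc k. g s) = (\<Sum>s<2 ^ k. \<Sum>m<2. g (m * 2 ^ k + s))"
proof -
  have "(\<Sum>s<2 ^ Suc k. g s) = (\<Sum>s<2 ^ k. g s) + (\<Sum>s = 2 ^ k..<2 ^ k + 2 ^ k. g s)"
    unfolding lessThan_atLeast0 by (subst sum.atLeastLessThan_concat) (auto simp: mult_2)
  also have "(\<Sum>s = 2 ^ k..<2 ^ k + 2 ^ k. g s) = (\<Sum>s<2 ^ k. g (2 ^ k + s))"
    using sum.shift_bounds_nat_ivl[of g 0 "2 ^ k" "2 ^ k"] by (simp add: lessThan_atLeast0 add.commute)
  finally show ?thesis
    by (simp add: numeral_2_eq_2 sum.distrib)
qed

lemma sum_square_power_Suc:
  fixes G :: "nat \<Rightarrow> nat \<Rightarrow> 'a::comm_monoid_add"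
  shows "(\<Sum>s<2 ^ Suc k. \<Sum>r<2 ^ Suc k. G s r)
    = (\<Sum>s<2 ^ k. \<Sum>r<2 ^ k. \<Sum>(m, b)\<in>{..<2} \<times> {..<2}. G (m * 2 ^ k + s) (b * 2 ^ k + r))"
  unfolding sum_lessThan_power_Suc sum.cartesian_product[symmetric]
  by (intro sum.cong refl sum.swap)

text \<open>The denominator is \<open>2 * 3\<^sup>2 * a\<close> with \<open>a = n + k\<close>.
  Removing one pair of bits lowers \<open>a\<close> by 1 and costs a factor 4 for the number of
  pairs and at most \<open>exp (1 / (2 * n))\<close>. For \<open>k = n\<close> the total loss over
  uniform averaging is thus bounded.\<close>

lemma sum_exp_compensated_le:
  assumes "n > 0" and "\<And>j. j < k \<Longrightarrow> e j < 2"
  shows "(\<Sum>s<2 ^ k. \<Sum>r<2 ^ k. exp ((compensated e k s r)\<^sup>2 / (18 * real (n + k))))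
    \<le> 4 ^ k * exp (real k / (2 * real n))"
  using assms(2)
proof (induction k)
  case 0
  show ?case
    by (simp add: compensated_def rev_discrepancy_def sawtooth_def rev_count_def)
next
  case (Suc k)
  let ?I = "{..<2::nat} \<times> {..<2::nat}"
  define E where "E k s r = exp ((compensated e k s r)\<^sup>2 / (18 * real (n + k)))" for k s r
  have step: "(\<Sum>(m, b)\<in>?I. E (Suc k) (m * 2 ^ k + s) (b * 2 ^ k + r))
      \<le> 4 * exp (1 / (2 * real n)) * E k s r" if "s < 2 ^ k" "r < 2 ^ k" for s r
  proof -
    define T where "T = compensated e k s r"
    define inc where "inc = (\<lambda>(m, b). compensated e (Suc k) (m * 2 ^ k + s) (b * 2 ^ k + r) - T)"
    have inc: "sum inc ?I = 0" "\<And>i. i \<in> ?I \<Longrightarrow> \<bar>inc i\<bar> \<le> 3"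
      using compensated_increment[of e k s r] Suc.prems that by (simp_all add: inc_def T_def)
    define a where "a = real (n + Suc k)"
    have a: "a > 1" "a - 1 = real (n + k)" "a \<ge> real n"
      using assms(1) by (auto simp: a_def)
    have "(\<Sum>(m, b)\<in>?I. E (Suc k) (m * 2 ^ k + s) (b * 2 ^ k + r))
        = (\<Sum>i\<in>?I. exp ((T + inc i)\<^sup>2 / (2 * 3\<^sup>2 * a)))"
      by (intro sum.cong refl) (auto simp: E_def inc_def a_def)
    also have "\<dots> \<le> real (card ?I) * (exp (1 / (2 * a)) * exp (T\<^sup>2 / (2 * 3\<^sup>2 * (a - 1))))"
      using inc a by (intro sum_exp_square_le) auto
    also have "\<dots> = 4 * exp (1 / (2 * a)) * E k s r"
      unfolding a(2) by (simp add: E_def T_def card_cartesian_product)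
    also have "\<dots> \<le> 4 * exp (1 / (2 * real n)) * E k s r"
      using a assms(1) by (intro mult_mono) (auto simp: E_def frac_le)
    finally show ?thesis .
  qed
  have "(\<Sum>s<2 ^ Suc k. \<Sum>r<2 ^ Suc k. E (Suc k) s r)
      \<le> (\<Sum>s<2 ^ k. \<Sum>r<2 ^ k. 4 * exp (1 / (2 * real n)) * E k s r)"
    unfolding sum_square_power_Suc by (intro sum_mono step) auto
  also have "\<dots> = 4 * exp (1 / (2 * real n)) * (\<Sum>s<2 ^ k. \<Sum>r<2 ^ k. E k s r)"
    by (simp add: sum_distrib_left)
  also have "\<dots> \<le> 4 * exp (1 / (2 * real n)) * (4 ^ k * exp (real k / (2 * real n)))"
    using Suc unfolding E_def by (intro mult_left_mono) auto
  also have "\<dots> = 4 ^ Suc k * exp (real (Suc k) / (2 * real n))"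
    by (simp add: add_divide_distrib exp_add)
  finally show ?case
    unfolding E_def .
qed

section \<open>Binary digits\<close>

text \<open>Horner's scheme, chosen to share its recursion with
  \<open>scrambled_rev\<close>.\<close>

fun digit_prefix :: "(nat \<Rightarrow> int) \<Rightarrow> nat \<Rightarrow> int" where
  "digit_prefix d 0 = 0"
| "digit_prefix d (Suc k) = 2 * digit_prefix d k + d (Suc k)"

lemma of_bdigits_eq_digit_prefix:
  assumes "\<And>i. i > n \<Longrightarrow> d i = 0"
  shows "of_bdigits d = real_of_int (digit_prefix d n) / 2 ^ n"
proof -
  have "of_bdigits d = (\<Sum>i<n. real_of_int (d (Suc i)) / 2 ^ Suc i)"
    unfolding of_bdigits_def using assms by (intro suminf_finite) auto
  also have "\<dots> = real_of_int (digit_prefix d n) / 2 ^ n"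
    by (induction n) (simp_all add: field_simps)
  finally show ?thesis .
qed

lemma digit_prefix_div:
  assumes "\<And>i. d i \<in> {0, 1}" "j \<le> n"
  shows "digit_prefix d n div 2 ^ (n - j) = digit_prefix d j"
  using assms(2)
proof (induction rule: dec_induct)
  case (step n)
  have "(2 * digit_prefix d n + d (Suc n)) div 2 = digit_prefix d n"
    using assms(1)[of "Suc n"] by auto
  moreover have "a div 2 ^ (Suc n - j) = a div 2 div 2 ^ (n - j)" for a :: int
    using step by (simp add: Suc_diff_le zdiv_zmult2_eq)
  ultimately show ?case
    using step by simp
qed simp

lemma bdigit_of_int_divide:
  assumes "i \<le> n"
  shows "bdigit i (real_of_int a / 2 ^ n) = a div 2 ^ (n - i) mod 2"
proof -
  have "2 ^ i * (real_of_int a / 2 ^ n) = real_of_int a / real_of_int (2 ^ (n - i))"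
    using assms power_add[of "2::real" i "n - i"] by (simp add: field_simps)
  then show ?thesis
    unfolding bdigit_def by (simp only: floor_divide_of_int_eq)
qed

lemma bdigit_of_int_divide_eq_0:
  assumes "i > n"
  shows "bdigit i (real_of_int a / 2 ^ n) = 0"
proof -
  have "2 ^ i * (real_of_int a / 2 ^ n) = real_of_int (2 * (2 ^ (i - Suc n) * a))"
    using assms power_add[of "2::real" "Suc n" "i - Suc n"] by (simp add: field_simps)
  then show ?thesis
    unfolding bdigit_def by (simp only: floor_of_int) simp
qed

lemma bdigit_of_bdigits:
  assumes "\<And>i. d i \<in> {0, 1}" "\<And>i. i > n \<Longrightarrow> d i = 0" "0 < j" "j \<le> n"
  shows "bdigit j (of_bdigits d) = d j"
proof -
  obtain j' where j: "j = Suc j'"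
    using assms(3) by (cases j) auto
  have "bdigit j (of_bdigits d) = digit_prefix d j mod 2"
    using assms by (simp add: of_bdigits_eq_digit_prefix[of n] bdigit_of_int_divide digit_prefix_div)
  also have "\<dots> = d j"
    using assms(1)[of j] unfolding j by auto
  finally show ?thesis .
qed

lemma bdigit_cases: "bdigit i x = 0 \<or> bdigit i x = 1"
  unfolding bdigit_def by linarith

text \<open>
  Bit \<open>k\<close> of \<open>\<tau>\<close>, counted from the lowest, is binary digit \<open>n - k\<close> of \<open>\<tau> / 2 ^ n\<close>.
\<close>

definition shift_digit :: "nat \<Rightarrow> real \<Rightarrow> nat \<Rightarrow> nat" where
  "shift_digit n \<sigma> k = nat (bdigit (n - k) \<sigma>)"

lemma shift_digit_less: "shift_digit n \<sigma> k < 2"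
  using bdigit_cases[of "n - k" \<sigma>] by (auto simp: shift_digit_def)

text \<open>Digit \<open>k + 1\<close> after reversal is digit \<open>n - k\<close> of the shifted
  number, that is, bit \<open>k\<close> of \<open>t\<close> plus the shift digit modulo 2. Both
  sides then follow the same recursion.\<close>

lemma digit_rev_digit_shift:
  "digit_rev n (digit_shift n \<sigma> (real t / 2 ^ n))
    = real (scrambled_rev (shift_digit n \<sigma>) n t) / 2 ^ n"
proof -
  define x where "x = real_of_int (int t) / 2 ^ n"
  define ds where "ds = (\<lambda>i. if i \<le> n then (bdigit i x + bdigit i \<sigma>) mod 2 else bdigit i x)"
  define dr where "dr = (\<lambda>i. if 1 \<le> i \<and> i \<le> n then bdigit (n + 1 - i) (digit_shift n \<sigma> x) else 0)"
  have ds: "ds i \<in> {0, 1}" "i > n \<Longrightarrow> ds i = 0" for i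
    using bdigit_cases[of i x] bdigit_of_int_divide_eq_0[of n i "int t"]
    by (auto simp: ds_def x_def)
  have dr: "dr (Suc k) = int ((t div 2 ^ k + shift_digit n \<sigma> k) mod 2)" if "k < n" for k
  proof -
    have "dr (Suc k) = ds (n - k)"
      using that bdigit_of_bdigits[of ds n "n - k"] ds
      by (simp add: dr_def digit_shift_def flip: ds_def)
    also have "\<dots> = (int t div 2 ^ k mod 2 + int (shift_digit n \<sigma> k)) mod 2"
      using that bdigit_cases[of "n - k" \<sigma>]
      by (auto simp: ds_def x_def bdigit_of_int_divide shift_digit_def simp del: of_int_of_nat_eq)
    also have "\<dots> = int ((t div 2 ^ k + shift_digit n \<sigma> k) mod 2)"
      by (simp add: zmod_int zdiv_int mod_simps)
    finally show ?thesis .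
  qed
  have "digit_prefix dr k = int (scrambled_rev (shift_digit n \<sigma>) k t)" if "k \<le> n" for k
    using that by (induction k) (simp_all add: dr)
  then have "real_of_int (digit_prefix dr n) = real (scrambled_rev (shift_digit n \<sigma>) n t)"
    by simp
  moreover have "of_bdigits dr = real_of_int (digit_prefix dr n) / 2 ^ n"
    by (rule of_bdigits_eq_digit_prefix) (simp add: dr_def)
  moreover have "digit_rev n (digit_shift n \<sigma> x) = of_bdigits dr"
    unfolding digit_rev_def dr_def by (rule refl)
  ultimately show ?thesis
    by (simp add: x_def)
qed

section \<open>The alternating shift 1/3\<close>

lemma bdigit_one_third: "bdigit (Suc i) (1 / 3) = of_bool (odd i)"
proof -
  have digit: "bdigit j (1 / 3) = 2 ^ j div 3 mod 2" for j
    unfolding bdigit_def using floor_divide_of_int_eq[of "2 ^ j" 3, where 'a = real] by simp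
  \<comment> \<open>The digits have period 2, so the residue of \<open>4 ^ j\<close> modulo 3
    determines them for either parity of \<open>i\<close>.\<close>
  have four: "(4::int) ^ j mod 3 = 1" for j
    using power_mod[of "4::int" 3 j] by simp
  obtain j where "i = 2 * j \<or> i = Suc (2 * j)"
    by (metis evenE oddE Suc_eq_plus1)
  then show ?thesis
  proof
    assume i: "i = 2 * j"
    have "2 * x div 3 mod 2 = 0" if "x mod 3 = 1" for x :: int
      using that by presburger
    from this[OF four[of j]] show ?thesis
      by (simp add: digit i power_mult)
  next
    assume i: "i = Suc (2 * j)"
    have "2 * (2 * x) div 3 mod 2 = 1" if "x mod 3 = 1" for x :: int
      using that by presburger
    from this[OF four[of j]] show ?thesis
      by (simp add: digit i power_mult)
  qed
qed

text \<open>Signs alternate, so they cancel in pairs. This keeps the accumulated drift of the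
  discrepancy bounded.\<close>

lemma sum_shift_digit_one_third:
  "\<bar>\<Sum>k<n. 1 - 2 * real (shift_digit n (1 / 3) k)\<bar> \<le> 1"
proof -
  have "(\<Sum>k<n. 1 - 2 * real (shift_digit n (1 / 3) k))
      = (\<Sum>k<n. (\<lambda>i. 1 - 2 * of_bool (odd i)) (n - Suc k))"
  proof (intro sum.cong refl)
    fix k assume "k \<in> {..<n}"
    then have "n - k = Suc (n - Suc k)"
      by auto
    then show "1 - 2 * real (shift_digit n (1 / 3) k) = (\<lambda>i. 1 - 2 * of_bool (odd i)) (n - Suc k)"
      by (simp add: shift_digit_def bdigit_one_third del: diff_Suc_Suc)
  qed
  also have "\<dots> = (\<Sum>i<n. 1 - 2 * of_bool (odd i))"
    by (rule sum.nat_diff_reindex)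
  also have "\<dots> = of_bool (odd n)"
    by (induction n) auto
  finally show ?thesis
    by simp
qed

section \<open>Discrepancy of initial segments\<close>

lemma vdC_initial_segment_eq:
  assumes "N > 0"
  shows "vdC_initial_segment n \<sigma> N =
    (\<lambda>t. ((real t + 1 / 2) / real N, (real (scrambled_rev (shift_digit n \<sigma>) n t) + 1 / 2) / 2 ^ n))
      ` {..<N}"
  unfolding vdC_initial_segment_def image_image lessThan_atLeast0
  by (intro image_cong refl) (use assms in \<open>simp add: vdC_point_def digit_rev_digit_shift field_simps\<close>)

lemma inj_on_vdC_initial_segment:
  fixes f :: "nat \<Rightarrow> real"
  assumes "N > 0"
  shows "inj_on (\<lambda>t. ((real t + 1 / 2) / real N, f t)) A"
  using assms by (auto simp: inj_on_def)

lemma card_vdC_initial_segment: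
  assumes "N > 0"
  shows "card (vdC_initial_segment n \<sigma> N) = N"
  unfolding vdC_initial_segment_eq[OF assms] using inj_on_vdC_initial_segment[OF assms]
  by (subst card_image) auto

lemma vdC_initial_segment_subset_unit_square:
  assumes "N > 0"
  shows "vdC_initial_segment n \<sigma> N \<subseteq> unit_square"
proof -
  have "(real (scrambled_rev e n t) + 1 / 2) / 2 ^ n \<le> 1" for e t
  proof -
    have "real (scrambled_rev e n t) + 1 \<le> 2 ^ n"
      using scrambled_rev_less[of e n t]
      by (metis Suc_eq_plus1 Suc_leI of_nat_Suc of_nat_le_iff of_nat_numeral of_nat_power add.commute)
    then show ?thesis
      by simp
  qed
  moreover have "(real t + 1 / 2) / real N \<le> 1" if "t < N" for t
    using that assms by simp
  ultimately show ?thesis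
    unfolding vdC_initial_segment_eq[OF assms] unit_square_def by auto
qed

text \<open>Rounding \<open>N * x\<close> to \<open>m\<close> and \<open>2 ^ n * y\<close> down to
  the reversal of \<open>r\<close> changes the count by at most 1 and the area term by at most 1/2 +
  1.\<close>

lemma discrepancy_vdC_initial_segment:
  fixes x y :: real
  assumes "N > 0" "N \<le> 2 ^ n" "m \<le> N" "r < 2 ^ n"
    and x: "real m - 1 / 2 \<le> real N * x" "real N * x \<le> real m + 1 / 2"
    and y: "real (scrambled_rev (shift_digit n \<sigma>) n r) \<le> 2 ^ n * y"
      "2 ^ n * y \<le> real (scrambled_rev (shift_digit n \<sigma>) n r) + 1" "0 \<le> y" "y \<le> 1"
  shows "\<bar>discrepancy (vdC_initial_segment n \<sigma> N) (x, y)
    - rev_discrepancy (shift_digit n \<sigma>) n m r\<bar> \<le> 3"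
proof -
  define \<rho> where "\<rho> = scrambled_rev (shift_digit n \<sigma>) n"
  define p where "p = (\<lambda>t. ((real t + 1 / 2) / real N, (real (\<rho> t) + 1 / 2) / 2 ^ n))"
  define w where "w = \<rho> r"
  define Q where "Q = {t. t < N \<and> real t + 1 / 2 < real N * x \<and> real (\<rho> t) + 1 / 2 < 2 ^ n * y}"
  define P where "P = {t. t < m \<and> \<rho> t < w}"
  have A: "vdC_initial_segment n \<sigma> N = p ` {..<N}"
    using assms(1) by (simp add: vdC_initial_segment_eq p_def \<rho>_def)
  have "p ` {..<N} \<inter> {0..<x} \<times> {0..<y} = p ` Q"
    using assms(1) by (auto simp: p_def Q_def field_simps)
  then have "card (p ` {..<N} \<inter> {0..<x} \<times> {0..<y}) = card Q"
    using inj_on_vdC_initial_segment[OF assms(1)] by (simp add: p_def card_image)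
  then have disc: "discrepancy (vdC_initial_segment n \<sigma> N) (x, y) = real (card Q) - real N * x * y"
    unfolding discrepancy_def card_vdC_initial_segment[OF assms(1)] by (simp add: A)
  have fin: "finite P" "finite Q"
    by (auto simp: P_def Q_def)
  \<comment> \<open>An extra index must have reversed value exactly \<open>w\<close>, hence be
    \<open>r\<close> by injectivity.\<close>
  have "Q \<subseteq> insert r P"
  proof
    fix t assume t: "t \<in> Q"
    then have "real t < real m"
      using x unfolding Q_def by auto
    moreover have "real (\<rho> t) < real w + 1"
      using t y unfolding Q_def w_def \<rho>_def by auto
    moreover have "t = r" if "\<rho> t = w"
      using that t assms inj_on_scrambled_rev[of "shift_digit n \<sigma>" n]
      unfolding Q_def w_def \<rho>_def by (auto dest: inj_onD)
    ultimately show "t \<in> insert r P"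
      unfolding P_def by force
  qed
  then have "card Q \<le> card (insert r P)"
    using fin by (intro card_mono) auto
  also have "\<dots> \<le> card P + 1"
    by (simp add: card_insert_if fin)
  finally have QP: "card Q \<le> card P + 1" .
  \<comment> \<open>Rounding in \<open>x\<close> can lose only the last index:
    \<open>t \<le> m - 2\<close> leaves enough room below \<open>N * x\<close>.\<close>
  have "P \<subseteq> insert (m - 1) Q"
  proof
    fix t assume t: "t \<in> P"
    have "t \<in> Q" if "t \<noteq> m - 1"
    proof -
      have "real t + 2 \<le> real m" "real (\<rho> t) + 1 \<le> real w"
        using t that unfolding P_def by auto
      then show ?thesis
        using x y t assms(3) unfolding P_def Q_def w_def \<rho>_def by auto
    qed
    then show "t \<in> insert (m - 1) Q"
      by blast
  qed
  then have "card P \<le> card (insert (m - 1) Q)"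
    using fin by (intro card_mono) auto
  also have "\<dots> \<le> card Q + 1"
    by (simp add: card_insert_if fin)
  finally have PQ: "card P \<le> card Q + 1" .
  have rev: "rev_discrepancy (shift_digit n \<sigma>) n m r = real (card P) - real m * (real w / 2 ^ n)"
    by (simp add: rev_discrepancy_def rev_count_def P_def w_def \<rho>_def)
  have "\<bar>real N * x * y - real m * y\<bar> \<le> 1 / 2"
  proof -
    have "\<bar>real N * x * y - real m * y\<bar> = \<bar>real N * x - real m\<bar> * y"
      using y by (simp add: abs_mult left_diff_distrib[symmetric])
    also have "\<dots> \<le> 1 / 2 * 1"
    proof (rule mult_mono)
      show "\<bar>real N * x - real m\<bar> \<le> 1 / 2"
        using x by linarith
    qed (use y in auto)
    finally show ?thesis
      by simp
  qed
  moreover have "\<bar>real m * y - real m * (real w / 2 ^ n)\<bar> \<le> 1"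
  proof -
    have "\<bar>y - real w / 2 ^ n\<bar> = y - real w / 2 ^ n"
      using y by (simp add: w_def \<rho>_def field_simps)
    also have "\<dots> = (2 ^ n * y - real w) / 2 ^ n"
      by (simp add: diff_divide_distrib)
    also have "\<dots> \<le> 1 / 2 ^ n"
      using y by (intro divide_right_mono) (auto simp: w_def \<rho>_def)
    finally have "\<bar>y - real w / 2 ^ n\<bar> \<le> 1 / 2 ^ n" .
    moreover have "real m \<le> 2 ^ n"
      using assms(2,3) by simp
    ultimately have "real m * \<bar>y - real w / 2 ^ n\<bar> \<le> 2 ^ n * (1 / 2 ^ n)"
      by (intro mult_mono) auto
    then have "\<bar>real m * (y - real w / 2 ^ n)\<bar> \<le> 1"
      by (simp add: abs_mult)
    then show ?thesis
      by (simp only: right_diff_distrib)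
  qed
  ultimately show ?thesis
    using QP PQ unfolding disc rev by linarith
qed

lemma abs_compensated_minus_rev_discrepancy_le:
  assumes "s < 2 ^ k"
  shows "\<bar>compensated (shift_digit k (1 / 3)) k s r - rev_discrepancy (shift_digit k (1 / 3)) k s r\<bar> \<le> 1"
proof -
  have "real s / 2 ^ k \<le> 1"
    using assms by simp
  moreover have "0 \<le> real s / 2 ^ k"
    by simp
  ultimately have "\<bar>sawtooth k s r\<bar> \<le> 1"
    unfolding sawtooth_def by (cases "r < s") auto
  moreover have "\<bar>\<Sum>j<k. (1 - 2 * real (shift_digit k (1 / 3) j)) / 8\<bar> \<le> 1 / 8"
    using sum_shift_digit_one_third[of k] by (simp flip: sum_divide_distrib)
  ultimately show ?thesis
    unfolding compensated_def by linarith
qed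

section \<open>Interpolation between the square-exponential and sup bounds\<close>

text \<open>With \<open>q = \<bar>D\<bar> / (84 * v)\<close>, the left side is at most
  \<open>q powr \<alpha> * v\<close>. The sup bound on \<open>D\<close> gives
  \<open>q \<le> 1\<close>, so the exponent drops to 2 uniformly in \<open>\<alpha>\<close>. Here 84
  is 3 * 28 and 7056 is 84 squared.\<close>

lemma powr_le_square_divide:
  fixes D L \<alpha> v :: real
  assumes "v > 0" "\<bar>D\<bar> \<le> 28 * v" "v \<le> L" "\<alpha> \<ge> 2"
  shows "\<bar>D / (84 * L powr (1 - 1 / \<alpha>))\<bar> powr \<alpha> \<le> D\<^sup>2 / (7056 * v)"
proof -
  define q where "q = \<bar>D\<bar> / (84 * v)"
  have q: "0 \<le> q" "q \<le> 1"
    using assms by (auto simp: q_def)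
  have "\<bar>D / (84 * L powr (1 - 1 / \<alpha>))\<bar> = \<bar>D\<bar> / (84 * L powr (1 - 1 / \<alpha>))"
    by (simp add: abs_divide abs_mult)
  also have "\<dots> \<le> \<bar>D\<bar> / (84 * v powr (1 - 1 / \<alpha>))"
    using assms by (intro divide_left_mono mult_left_mono powr_mono2 mult_pos_pos) auto
  also have "\<dots> = q * v powr (1 / \<alpha>)"
    using assms by (simp add: q_def powr_diff)
  finally have "\<bar>D / (84 * L powr (1 - 1 / \<alpha>))\<bar> powr \<alpha> \<le> (q * v powr (1 / \<alpha>)) powr \<alpha>"
    using assms by (intro powr_mono2) auto
  also have "\<dots> = q powr \<alpha> * v"
    using assms q by (simp add: powr_mult powr_powr)
  also have "q powr \<alpha> * v \<le> q\<^sup>2 * v"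
  proof (cases "q = 0")
    case False
    then have "q powr \<alpha> \<le> q powr 2"
      using q assms by (intro powr_mono') auto
    also have "\<dots> = q\<^sup>2"
      using q False by simp
    finally show ?thesis
      using assms by simp
  qed simp
  also have "\<dots> = D\<^sup>2 / (7056 * v)"
    using assms by (simp add: q_def power2_eq_square field_simps)
  finally show ?thesis .
qed

text \<open>Convexity between 0 and \<open>X\<close>. It turns a merely bounded exponential moment
  into one at most 1 by enlarging the norm constant.\<close>

lemma exp_scaled_minus_1_le:
  fixes t X :: real
  assumes "0 \<le> t" "t \<le> 1"
  shows "exp (t * X) - 1 \<le> t * exp X"
proof -
  have "exp ((1 - t) *\<^sub>R 0 + t *\<^sub>R X) \<le> (1 - t) * exp 0 + t * exp X"
    by (rule convex_onD[OF exp_convex]) (use assms in auto)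
  then show ?thesis
    using assms by simp
qed

section \<open>Integration over the unit square\<close>

text \<open>Centred at \<open>m / N\<close> horizontally, so that \<open>m\<close> is the integer
  nearest to \<open>N * x\<close>; the cells for \<open>m = 0\<close> and \<open>m = N\<close>
  extend beyond the square.\<close>

definition grid_cell :: "nat \<Rightarrow> nat \<Rightarrow> nat \<Rightarrow> nat \<Rightarrow> (real \<times> real) set" where
  "grid_cell N n m w =
     cbox ((real m - 1 / 2) / real N, real w / 2 ^ n) ((real m + 1 / 2) / real N, (real w + 1) / 2 ^ n)"

lemma emeasure_grid_cell:
  assumes "N > 0"
  shows "emeasure lborel (grid_cell N n m w) = ennreal (1 / (real N * 2 ^ n))"
proof -
  have "emeasure lborel (grid_cell N n m w)
      = emeasure lborel (cbox ((real m - 1 / 2) / real N) ((real m + 1 / 2) / real N))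
        * emeasure lborel (cbox (real w / 2 ^ n) ((real w + 1) / 2 ^ n))"
    unfolding grid_cell_def cbox_Pair_eq lborel_prod[symmetric]
    by (rule lborel.emeasure_pair_measure_Times) auto
  also have "\<dots> = ennreal (1 / real N) * ennreal (1 / 2 ^ n)"
    using assms by (simp add: divide_right_mono flip: diff_divide_distrib)
  finally show ?thesis
    by (simp add: ennreal_mult'[symmetric])
qed

lemma unit_square_grid_cell:
  assumes "N > 0" "(x, y) \<in> unit_square"
  obtains m w where "m \<le> N" "w < 2 ^ n" "(x, y) \<in> grid_cell N n m w"
proof
  define m where "m = nat \<lfloor>real N * x + 1 / 2\<rfloor>"
  \<comment> \<open>The cap matters for \<open>y = 1\<close>, which belongs to the closed top
    cell.\<close>
  define w where "w = min (nat \<lfloor>2 ^ n * y\<rfloor>) (2 ^ n - 1)"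
  have xy: "0 \<le> x" "x \<le> 1" "0 \<le> y" "y \<le> 1"
    using assms(2) by (auto simp: unit_square_def)
  have m: "real m \<le> real N * x + 1 / 2" "real N * x + 1 / 2 < real m + 1"
    using xy unfolding m_def by (simp_all add: of_nat_nat)
  have "real N * x \<le> real N"
    using xy by (simp add: mult_left_le)
  with m show "m \<le> N"
    by linarith
  have "w \<le> 2 ^ n - 1"
    by (simp add: w_def)
  moreover have "(0::nat) < 2 ^ n"
    by simp
  ultimately show "w < 2 ^ n"
    by linarith
  have w: "real w \<le> 2 ^ n * y \<and> 2 ^ n * y \<le> real w + 1"
  proof (cases "nat \<lfloor>2 ^ n * y\<rfloor> \<le> 2 ^ n - 1")
    case True
    then have "real w = of_int \<lfloor>2 ^ n * y\<rfloor>"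
      using xy by (simp add: w_def min_def of_nat_nat)
    then show ?thesis
      by linarith
  next
    case False
    then have "real w + 1 = 2 ^ n"
      by (simp add: w_def min_def of_nat_diff)
    moreover have "2 ^ n * y \<le> 2 ^ n"
      using xy by (simp add: mult_left_le)
    moreover have "w \<le> nat \<lfloor>2 ^ n * y\<rfloor>"
      by (simp add: w_def)
    then have "real w \<le> real (nat \<lfloor>2 ^ n * y\<rfloor>)"
      by (simp only: of_nat_le_iff)
    then have "real w \<le> 2 ^ n * y"
      using xy by (simp add: of_nat_nat) linarith
    ultimately show ?thesis
      by simp
  qed
  show "(x, y) \<in> grid_cell N n m w"
    using m w assms(1) by (simp add: grid_cell_def cbox_Pair_eq field_simps)
qed

text \<open>The integrand is dominated by the sum of \<open>G\<close> times the cell indicators;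
  overlaps and overhang only enlarge it. Rows are indexed through \<open>\<rho>\<close> because the
  compensated discrepancy takes the height before reversal.\<close>

lemma nn_integral_unit_square_le_grid:
  fixes G :: "nat \<Rightarrow> nat \<Rightarrow> real"
  assumes "N > 0" and G: "\<And>m r. 0 \<le> G m r"
    and \<rho>: "bij_betw \<rho> {..<2 ^ n} {..<2 ^ n}"
    and f: "\<And>p m r. p \<in> unit_square \<Longrightarrow> m \<le> N \<Longrightarrow> r < 2 ^ n \<Longrightarrow> p \<in> grid_cell N n m (\<rho> r)
      \<Longrightarrow> f p \<le> G m r"
  shows "(\<integral>\<^sup>+p\<in>unit_square. ennreal (f p) \<partial>lborel)
    \<le> ennreal ((\<Sum>m\<le>N. \<Sum>r<2 ^ n. G m r) / (real N * 2 ^ n))"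
proof -
  let ?I = "{..N} \<times> {..<2 ^ n}"
  let ?h = "\<lambda>p (m, r). ennreal (G m r) * indicator (grid_cell N n m (\<rho> r)) p"
  have meas: "grid_cell N n m w \<in> sets borel" for m w
    by (simp add: grid_cell_def)
  have "(\<integral>\<^sup>+p\<in>unit_square. ennreal (f p) \<partial>lborel) \<le> (\<integral>\<^sup>+p. (\<Sum>i\<in>?I. ?h p i) \<partial>lborel)"
  proof (rule nn_integral_mono)
    fix p :: "real \<times> real"
    show "ennreal (f p) * indicator unit_square p \<le> (\<Sum>i\<in>?I. ?h p i)"
    proof (cases "p \<in> unit_square")
      case True
      then obtain m w where "m \<le> N" "w < 2 ^ n" and p: "p \<in> grid_cell N n m w"
        using unit_square_grid_cell[OF assms(1)] by (metis surj_pair)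
      moreover obtain r where "r < 2 ^ n" "w = \<rho> r"
        using bij_betw_imp_surj_on[OF \<rho>] \<open>w < 2 ^ n\<close> by blast
      ultimately have "ennreal (f p) \<le> ?h p (m, r)"
        using f[OF True] by (simp add: ennreal_leI)
      also have "\<dots> \<le> (\<Sum>i\<in>?I. ?h p i)"
        using \<open>m \<le> N\<close> \<open>r < 2 ^ n\<close> by (intro member_le_sum) auto
      finally show ?thesis
        using True by simp
    qed simp
  qed
  also have "\<dots> = (\<Sum>i\<in>?I. \<integral>\<^sup>+p. ?h p i \<partial>lborel)"
    by (rule nn_integral_sum) (auto intro!: borel_measurable_times_ennreal borel_measurable_indicator meas)
  also have "\<dots> = (\<Sum>(m, r)\<in>?I. ennreal (G m r / (real N * 2 ^ n)))"
    using meas G assms(1)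
    by (intro sum.cong refl)
      (auto simp: nn_integral_cmult_indicator emeasure_grid_cell simp flip: ennreal_mult')
  also have "\<dots> = ennreal (\<Sum>(m, r)\<in>?I. G m r / (real N * 2 ^ n))"
    using G by (simp add: case_prod_unfold sum_ennreal)
  also have "(\<Sum>(m, r)\<in>?I. G m r / (real N * 2 ^ n)) = (\<Sum>m\<le>N. \<Sum>r<2 ^ n. G m r) / (real N * 2 ^ n)"
    by (simp add: sum_divide_distrib flip: sum.cartesian_product)
  finally show ?thesis .
qed

section \<open>The Orlicz norm bound\<close>

lemma quarter_le_ln:
  fixes N n :: nat
  assumes "2 \<le> N" "2 ^ n \<le> N" "N < 2 ^ Suc n"
  shows "real (Suc n) / 4 \<le> ln (real N)"
proof -
  have "n \<noteq> 0"
    using assms by (cases "n = 0") auto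
  have "real n * (2 / 3) \<le> real n * ln 2"
    using ln2_ge_two_thirds by (intro mult_left_mono) auto
  also have "\<dots> = ln (2 ^ n)"
    by (simp add: ln_realpow)
  also have "\<dots> \<le> ln (real N)"
    using assms by simp
  finally have "real n * (2 / 3) \<le> ln (real N)" .
  moreover have "real n \<ge> 1"
    using \<open>n \<noteq> 0\<close> by linarith
  ultimately show ?thesis
    by simp
qed

lemma exp_young_discrepancy_le:
  fixes \<alpha> :: real and p :: "real \<times> real"
  assumes N: "2 \<le> N" "2 ^ n' \<le> N" "N < 2 ^ n" "n = Suc n'" and "\<alpha> \<ge> 2"
    and p: "p \<in> unit_square" "m \<le> N" "r < 2 ^ n"
      "p \<in> grid_cell N n m (scrambled_rev (shift_digit n (1 / 3)) n r)"
  shows "exp_young \<alpha> (discrepancy (vdC_initial_segment n (1 / 3) N) p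
      / (84 * ln (real N) powr (1 - 1 / \<alpha>)))
    \<le> exp 1 / 20 * exp ((compensated (shift_digit n (1 / 3)) n m r)\<^sup>2 / (18 * real (n + n)))"
proof -
  define e where "e = shift_digit n (1 / 3)"
  define D where "D = discrepancy (vdC_initial_segment n (1 / 3) N) p"
  define T where "T = compensated e n m r"
  obtain x y where xy: "p = (x, y)"
    by fastforce
  \<comment> \<open>Strictness of \<open>N < 2 ^ n\<close> is what lets \<open>m = N\<close> fit
    into \<open>n\<close> bits.\<close>
  have "m < 2 ^ n"
    using N p by simp
  have "real n \<ge> 1"
    using N by simp
  have "\<bar>D - rev_discrepancy e n m r\<bar> \<le> 3"
    unfolding D_def e_def xy using N p
    by (intro discrepancy_vdC_initial_segment)
      (auto simp: xy grid_cell_def cbox_Pair_eq unit_square_def field_simps)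
  moreover have "\<bar>T - rev_discrepancy e n m r\<bar> \<le> 1"
    unfolding T_def e_def by (rule abs_compensated_minus_rev_discrepancy_le) fact
  ultimately have DT: "\<bar>D - T\<bar> \<le> 4"
    by linarith
  have "\<bar>T\<bar> \<le> 3 * real n"
    unfolding T_def using \<open>m < 2 ^ n\<close> p
    by (intro abs_compensated_le) (auto simp: e_def shift_digit_less)
  \<comment> \<open>\<open>3 * n + 4 \<le> 7 * n\<close>, written with \<open>v = n / 4\<close>, the
    lower bound for \<open>ln N\<close>.\<close>
  with DT \<open>real n \<ge> 1\<close> have "\<bar>D\<bar> \<le> 28 * (real n / 4)"
    by linarith
  then have "\<bar>D / (84 * ln (real N) powr (1 - 1 / \<alpha>))\<bar> powr \<alpha> \<le> D\<^sup>2 / (7056 * (real n / 4))"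
    using quarter_le_ln[OF N(1,2)] N assms(5) by (intro powr_le_square_divide) auto
  \<comment> \<open>7056 / 4 = 1764 exceeds 20 * 72 = 1440; the spare factor 1/20 is pulled out of
    the exponential next.\<close>
  also have "\<dots> \<le> 1 / 20 * (D\<^sup>2 / (72 * real n))"
    using \<open>real n \<ge> 1\<close> by (simp add: field_simps)
  finally have "exp_young \<alpha> (D / (84 * ln (real N) powr (1 - 1 / \<alpha>)))
      \<le> exp (1 / 20 * (D\<^sup>2 / (72 * real n))) - 1"
    by (simp add: exp_young_def)
  also have "\<dots> \<le> 1 / 20 * exp (D\<^sup>2 / (72 * real n))"
    by (rule exp_scaled_minus_1_le) auto
  also have "\<dots> \<le> 1 / 20 * exp (1 + T\<^sup>2 / (18 * real (n + n)))"
  proof -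
    have "D\<^sup>2 \<le> 2 * T\<^sup>2 + 2 * (D - T)\<^sup>2"
      using zero_le_power2[of "D - 2 * T"] by (simp add: power2_eq_square algebra_simps)
    moreover have "(D - T)\<^sup>2 \<le> 4\<^sup>2"
      using DT abs_le_square_iff[of "D - T" 4] by simp
    ultimately have "D\<^sup>2 \<le> 2 * T\<^sup>2 + 72 * real n"
      using \<open>real n \<ge> 1\<close> by simp
    then have "D\<^sup>2 / (72 * real n) \<le> 1 + T\<^sup>2 / (18 * real (n + n))"
      using \<open>real n \<ge> 1\<close> by (simp add: field_simps)
    then show ?thesis
      by simp
  qed
  also have "\<dots> = exp 1 / 20 * exp (T\<^sup>2 / (18 * real (n + n)))"
    by (simp add: exp_add)
  finally show ?thesis
    unfolding D_def T_def e_def .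
qed

lemma nn_integral_exp_young_discrepancy_le:
  fixes \<alpha> :: real
  assumes N: "2 \<le> N" "2 ^ n' \<le> N" "N < 2 ^ n" "n = Suc n'" and "\<alpha> \<ge> 2"
  shows "(\<integral>\<^sup>+p\<in>unit_square. ennreal (exp_young \<alpha> (discrepancy (vdC_initial_segment n (1 / 3) N) p
      / (84 * ln (real N) powr (1 - 1 / \<alpha>)))) \<partial>lborel) \<le> 1"
proof -
  define e where "e = shift_digit n (1 / 3)"
  define G where "G = (\<lambda>m r. exp 1 / 20 * exp ((compensated e n m r)\<^sup>2 / (18 * real (n + n))))"
  have "(\<integral>\<^sup>+p\<in>unit_square. ennreal (exp_young \<alpha> (discrepancy (vdC_initial_segment n (1 / 3) N) p
      / (84 * ln (real N) powr (1 - 1 / \<alpha>)))) \<partial>lborel)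
      \<le> ennreal ((\<Sum>m\<le>N. \<Sum>r<2 ^ n. G m r) / (real N * 2 ^ n))"
    using N(1) bij_betw_scrambled_rev[of e n] exp_young_discrepancy_le[OF assms]
    by (intro nn_integral_unit_square_le_grid) (auto simp: G_def e_def)
  also have "(\<Sum>m\<le>N. \<Sum>r<2 ^ n. G m r) / (real N * 2 ^ n) \<le> 1"
  proof -
    \<comment> \<open>Extending the sum to all \<open>n\<close>-bit \<open>m\<close> costs at most a
      factor of order \<open>2 ^ n / N \<le> 2\<close> and makes the martingale estimate
      applicable.\<close>
    have "(\<Sum>m\<le>N. \<Sum>r<2 ^ n. G m r) \<le> (\<Sum>m<2 ^ n. \<Sum>r<2 ^ n. G m r)"
      using N by (intro sum_mono2 sum_nonneg) (auto simp: G_def)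
    also have "\<dots> = exp 1 / 20
        * (\<Sum>m<2 ^ n. \<Sum>r<2 ^ n. exp ((compensated e n m r)\<^sup>2 / (18 * real (n + n))))"
      by (simp add: G_def sum_distrib_left)
    also have "\<dots> \<le> exp 1 / 20 * (4 ^ n * exp (real n / (2 * real n)))"
      using N by (intro mult_left_mono sum_exp_compensated_le) (auto simp: e_def shift_digit_less)
    also have "\<dots> \<le> 3 / 20 * (4 ^ n * 3)"
    proof (intro mult_mono divide_right_mono)
      have "exp (real n / (2 * real n)) \<le> exp (1::real)"
        using N by simp
      then show "exp (real n / (2 * real n)) \<le> 3"
        using exp_le by linarith
    qed (use exp_le in auto)
    \<comment> \<open>The factor 1/20 was chosen for this: 9/20 is below 1/2, which absorbs
      \<open>2 ^ n \<le> 2 * N\<close>.\<close>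
    also have "\<dots> \<le> (2 ^ n / 2) * 2 ^ n"
      by (simp add: power_mult_distrib[symmetric])
    also have "\<dots> \<le> real N * 2 ^ n"
    proof (rule mult_right_mono)
      have "2 ^ n' \<le> real N"
        using N(2) by simp
      then show "2 ^ n / 2 \<le> real N"
        using N(4) by simp
    qed simp
    finally show ?thesis
      using N(1) by simp
  qed
  finally show ?thesis
    by (simp add: ennreal_leI)
qed

theorem theorem1p2:
  "\<exists>C::real. C > 0 \<and>
     (\<forall>N::nat. N \<ge> 2 \<longrightarrow>
       (\<exists>A :: (real \<times> real) set.
          A \<subseteq> unit_square \<and> finite A \<and> card A = N \<and>
          (\<exists>n \<sigma>. n \<ge> 1 \<and> \<sigma> \<in> {0..<1} \<and>
             (A = vdC_set n \<sigma> \<or>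
              N \<le> 2 ^ n \<and> A = vdC_initial_segment n \<sigma> N)) \<and>
          (\<forall>\<alpha>::real. \<alpha> \<ge> 2 \<longrightarrow>
             exp_Orlicz_norm \<alpha> (discrepancy A)
               \<le> ennreal (C * ln (real N) powr (1 - 1 / \<alpha>)))))"
proof (intro exI[of _ 84] conjI allI impI)
  fix N :: nat
  assume N: "N \<ge> 2"
  obtain n' where n': "2 ^ n' \<le> N" "N < 2 ^ (n' + 1)"
    using ex_power_ivl1[of 2 N] N by auto
  define n where "n = Suc n'"
  define A where "A = vdC_initial_segment n (1 / 3) N"
  have "A \<subseteq> unit_square" "card A = N"
    using N by (simp_all add: A_def vdC_initial_segment_subset_unit_square card_vdC_initial_segment)
  moreover from this N have "finite A"
    using card_ge_0_finite[of A] by simp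
  moreover have "\<exists>n \<sigma>. n \<ge> 1 \<and> \<sigma> \<in> {0..<1} \<and>
      (A = vdC_set n \<sigma> \<or> N \<le> 2 ^ n \<and> A = vdC_initial_segment n \<sigma> N)"
    using n' by (intro exI[of _ n] exI[of _ "1 / 3"]) (simp add: A_def n_def)
  \<comment> \<open>The right-hand side is itself an admissible \<open>K\<close>; it is positive
    because \<open>N \<ge> 2\<close>.\<close>
  moreover have "exp_Orlicz_norm \<alpha> (discrepancy A) \<le> ennreal (84 * ln (real N) powr (1 - 1 / \<alpha>))"
    if "\<alpha> \<ge> 2" for \<alpha> :: real
    unfolding exp_Orlicz_norm_def A_def
    using nn_integral_exp_young_discrepancy_le[of N n' n \<alpha>] N n' that
    by (intro Inf_lower imageI) (simp add: n_def)
  ultimately show "\<exists>A. A \<subseteq> unit_square \<and> finite A \<and> card A = N \<and>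
      (\<exists>n \<sigma>. n \<ge> 1 \<and> \<sigma> \<in> {0..<1} \<and>
        (A = vdC_set n \<sigma> \<or> N \<le> 2 ^ n \<and> A = vdC_initial_segment n \<sigma> N)) \<and>
      (\<forall>\<alpha>::real. \<alpha> \<ge> 2 \<longrightarrow>
        exp_Orlicz_norm \<alpha> (discrepancy A) \<le> ennreal (84 * ln (real N) powr (1 - 1 / \<alpha>)))"
    by blast
qed simp

end
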